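(* Let $$A=\{(m,n): k\in\mathbb{N}_{\ge1}\setminus 3\mathbb{N}_{\ge1},\ m=(k^2-1)/3,\ n=2k+m+2\}$$ (that is, $k$ ranges over $1,2,4,5,7,8,\dots$). The orthogonal dice $\kappa_{m,n}$ with support $\{m,m+1,\dots,n-1,n\}$ for integers $0\le m<n$ are completely enumerated by the collection $\mathcal{S}=\{\kappa_{m,n}:(m,n)\in A\}$; that is, for integers $0\le m<n$, $\kappa_{m,n}$ is an orthogonal die if and only if $(m,n)\in A$. Moreover $|\mathcal{S}|=\infty$, and $m/n\to1$ as $m,n\to\infty$ along $(m,n)\in A$. Furthermore, for each $\kappa_{m,n}\in\mathcal{S}$, the integer $n-m+1$ is a product of one or more primes, each having value equal to or greater than five.
   Context: For integers $0\le m\le n$, not both zero, $\kappa_{m,n}$ denotes the discrete uniform distribution on $\{m,m+1,\dots,n\}$, with mean $c=(m+n)/2$ and variance $\delta^2=((n-m+1)^2-1)/12$. It is called an orthogonal die if its mean equals its variance, $c=\delta^2$. $\mathbb{N}_{\ge1}$ is the set of positive integers and $3\mathbb{N}_{\ge1}$ the set of positive multiples of three. *)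

theory Defs
  imports "HOL-Probability.Probability" "HOL-Computational_Algebra.Primes"
begin

definition die :: "nat \<Rightarrow> nat \<Rightarrow> nat pmf" where
  "die m n = pmf_of_set {m..n}"

(* The guards delimit the family of dice: pmf_of_set is unspecified on the empty set
   (m > n), and the point mass at 0 (m = n = 0) is excluded. *)
definition orthogonal_die :: "nat \<Rightarrow> nat \<Rightarrow> bool" where
  "orthogonal_die m n \<longleftrightarrow> m \<le> n \<and> \<not> (m = 0 \<and> n = 0) \<and>
     measure_pmf.expectation (die m n) real = measure_pmf.variance (die m n) real"

definition die_params :: "(nat \<times> nat) set" where
  "die_params = {(m, n). \<exists>k::nat. k \<in> {1..} - {3 * j | j. j \<ge> 1} \<and>
     real m = ((real k)\<^sup>2 - 1) / 3 \<and> n = 2 * k + m + 2}"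

definition dice :: "nat pmf set" where
  "dice = {die m n | m n. (m, n) \<in> die_params}"

(* m and n tend to infinity jointly while (m, n) ranges over die_params *)
definition along_params :: "(nat \<times> nat) filter" where
  "along_params = inf (at_top \<times>\<^sub>F at_top) (principal die_params)"

(* Hence a limit along this filter is not a vacuous claim. *)
lemma along_params_neq_bot: "along_params \<noteq> bot"
proof
  assume "along_params = bot"
  then have "eventually (\<lambda>x. x \<notin> die_params) (at_top \<times>\<^sub>F at_top)"
    unfolding along_params_def trivial_limit_def by (simp add: eventually_inf_principal)
  then obtain P Q :: "nat \<Rightarrow> bool" where PQ: "eventually P at_top" "eventually Q at_top"
    "\<And>m n. P m \<Longrightarrow> Q n \<Longrightarrow> (m, n) \<notin> die_params"
    unfolding eventually_prod_filter by blast
  obtain a b where a: "\<And>m. m \<ge> a \<Longrightarrow> P m" and b: "\<And>n. n \<ge> b \<Longrightarrow> Q n"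
    using PQ(1,2) unfolding eventually_at_top_linorder by blast
  define t where "t = a + b + 1"
  define m where "m = 3 * t\<^sup>2 + 2 * t"
  define k where "k = 3 * t + 1"
  have "t \<le> m" by (simp add: m_def)
  then have "a \<le> m" "b \<le> 2 * k + m + 2" by (auto simp: t_def)
  moreover have "(m, 2 * k + m + 2) \<in> die_params"
  proof -
    have "real m = ((real k)\<^sup>2 - 1) / 3"
      by (simp add: m_def k_def power2_eq_square field_simps)
    moreover have "k \<in> {1..} - {3 * j | j. j \<ge> 1}"
      unfolding k_def by (auto, presburger)
    ultimately show ?thesis unfolding die_params_def by blast
  qed
  ultimately show False using a b PQ(3) by blast
qed

end

theory Submission
  imports Defs
begin

text \<open>
  Everything about the uniform distribution on \<open>{m..m + d}\<close> is governed by the width \<open>d\<close>: its mean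
  is \<open>m + d / 2\<close> and its variance is \<open>d (d + 2) / 12\<close>, so mean and variance agree exactly when
  \<open>12 m = d\<^sup>2 - 4 d\<close>. This forces \<open>d\<close> to be even, and completing the square with \<open>d = 2 k + 2\<close> turns
  the equation into \<open>3 m + 1 = k\<^sup>2\<close>. A natural number \<open>m\<close> solving the latter exists if and only if
  \<open>3\<close> does not divide \<open>k\<close>, whence the enumeration (\<open>orthogonal_die_iff_params\<close>).

  The remaining claims are read off from \<open>3 m + 1 = k\<^sup>2\<close>. There are infinitely many admissible \<open>k\<close>,
  and a die determines its support, so there are infinitely many dice. Next,
  \<open>3 n = (k + 1) (k + 5)\<close> and \<open>3 m = (k - 1) (k + 1)\<close>, so that \<open>m / n = 1 - 6 / (k + 5)\<close>, while \<open>k + 5\<close>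
  is at least \<open>sqrt n\<close>; this gives the limit. Finally, the support has \<open>2 k + 3\<close> elements, an odd
  number prime to \<open>3\<close>, so none of its prime factors is smaller than \<open>5\<close>.
\<close>

section \<open>Mean and variance of a die\<close>

lemma sum_real_interval:
  "(\<Sum>i\<in>{m..m + d}. real i) = (real d + 1) * (real m + real d / 2)"
  by (induction d) (simp_all add: field_simps)

text \<open>
  The centre \<open>c\<close> is a free parameter, since the mean itself depends on \<open>d\<close> and would not stay fixed
  in an induction on \<open>d\<close>.
\<close>

lemma sum_square_deviation_interval:
  fixes c :: real
  shows "(\<Sum>i\<in>{m..m + d}. (real i - c)\<^sup>2) =
    (real d + 1) * ((real m - c)\<^sup>2 + (real m - c) * real d + real d * (2 * real d + 1) / 6)"
  by (induction d) (simp_all add: field_simps power2_eq_square)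

lemma expectation_die:
  "measure_pmf.expectation (die m (m + d)) real = real m + real d / 2"
proof -
  have "measure_pmf.expectation (die m (m + d)) real = (\<Sum>i\<in>{m..m + d}. real i) / (real d + 1)"
    unfolding die_def by (subst integral_pmf_of_set) (simp_all add: add.commute)
  then show ?thesis
    unfolding sum_real_interval by simp
qed

lemma variance_die:
  "measure_pmf.variance (die m (m + d)) real = real d * (real d + 2) / 12"
proof -
  define c where "c = real m + real d / 2"
  have "measure_pmf.variance (die m (m + d)) real =
      (\<Sum>i\<in>{m..m + d}. (real i - c)\<^sup>2) / (real d + 1)"
    unfolding expectation_die c_def[symmetric] unfolding die_def
    by (subst integral_pmf_of_set) (simp_all add: add.commute)
  also have "\<dots> = (real m - c)\<^sup>2 + (real m - c) * real d + real d * (2 * real d + 1) / 6"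
    unfolding sum_square_deviation_interval by simp
  also have "\<dots> = real d * (real d + 2) / 12"
    by (simp add: c_def field_simps power2_eq_square)
  finally show ?thesis .
qed

section \<open>The quadratic equation for orthogonality\<close>

lemma orthogonal_die_iff_quadratic:
  assumes "d > 0"
  shows "orthogonal_die m (m + d) \<longleftrightarrow> 12 * m + 4 * d = d\<^sup>2"
proof -
  have "orthogonal_die m (m + d) \<longleftrightarrow> real m + real d / 2 = real d * (real d + 2) / 12"
    using assms unfolding orthogonal_die_def variance_die unfolding expectation_die by simp
  also have "\<dots> \<longleftrightarrow> real (12 * m + 4 * d) = real (d\<^sup>2)"
    by (auto simp: field_simps power2_eq_square)
  finally show ?thesis
    by (simp only: of_nat_eq_iff)
qed

text \<open>
  The number \<open>3 m + 1\<close> is positive and leaves the remainder \<open>1\<close> modulo \<open>3\<close>, so every \<open>k\<close> whose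
  square it is must be positive and prime to \<open>3\<close>.
\<close>

lemma die_params_iff:
  "(m, n) \<in> die_params \<longleftrightarrow> (\<exists>k. 3 * m + 1 = k\<^sup>2 \<and> n = 2 * k + m + 2)"
proof -
  have eq: "real m = ((real k)\<^sup>2 - 1) / 3 \<longleftrightarrow> 3 * m + 1 = k\<^sup>2" for k
  proof -
    have "real m = ((real k)\<^sup>2 - 1) / 3 \<longleftrightarrow> real (3 * m + 1) = real (k\<^sup>2)"
      by (auto simp: field_simps)
    then show ?thesis by (simp only: of_nat_eq_iff)
  qed
  have admissible: "k \<in> {1..} - {3 * j | j. j \<ge> 1}" if k: "3 * m + 1 = k\<^sup>2" for k
  proof -
    have "k \<noteq> 3 * j" for j
    proof
      assume "k = 3 * j"
      with k have "3 * m + 1 = 3 * (3 * j\<^sup>2)" by (simp add: power2_eq_square)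
      then show False by presburger
    qed
    moreover have "k \<noteq> 0" using k by (intro notI) simp
    ultimately show ?thesis by auto
  qed
  show ?thesis
    unfolding die_params_def using admissible by (auto simp only: mem_Collect_eq case_prod_conv eq)
qed

theorem orthogonal_die_iff_params:
  assumes "m < n"
  shows "orthogonal_die m n \<longleftrightarrow> (m, n) \<in> die_params"
proof -
  obtain d where d: "d > 0" "n = m + d"
    using assms less_imp_add_positive by blast
  have "12 * m + 4 * d = d\<^sup>2 \<longleftrightarrow> (\<exists>k. 3 * m + 1 = k\<^sup>2 \<and> d = 2 * k + 2)"
  proof
    assume quad: "12 * m + 4 * d = d\<^sup>2"
    then have "even (d\<^sup>2)" by (metis dvd_add dvd_mult2 even_numeral)
    then have "even d" by simp
    with \<open>d > 0\<close> obtain e where "d = 2 * e" "e > 0" by auto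
    then obtain k where k: "d = 2 * k + 2" by (cases e) auto
    \<comment> \<open>Completing the square: the equation becomes \<open>12 m + 4 = (d - 2)\<^sup>2\<close>, and \<open>d - 2 = 2 k\<close>.\<close>
    from quad have "3 * m + 1 = k\<^sup>2"
      unfolding k by (simp add: power2_eq_square)
    with k show "\<exists>k. 3 * m + 1 = k\<^sup>2 \<and> d = 2 * k + 2" by blast
  next
    assume "\<exists>k. 3 * m + 1 = k\<^sup>2 \<and> d = 2 * k + 2"
    then obtain k where k: "3 * m + 1 = k\<^sup>2" "d = 2 * k + 2" by blast
    have "12 * m + 4 * d = 4 * (3 * m + 1) + 8 * k + 4" by (simp add: k(2))
    also have "\<dots> = d\<^sup>2" unfolding k(1) by (simp add: k(2) power2_eq_square)
    finally show "12 * m + 4 * d = d\<^sup>2" .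
  qed
  then show ?thesis
    using orthogonal_die_iff_quadratic[OF d(1)] unfolding d(2) die_params_iff by simp
qed

section \<open>Infinitely many dice\<close>

text \<open>A nonempty interval is the support of its uniform distribution and determines its endpoints.\<close>

lemma die_eq_iff:
  assumes "m \<le> n" "m' \<le> n'"
  shows "die m n = die m' n' \<longleftrightarrow> m = m' \<and> n = n'"
proof
  assume "die m n = die m' n'"
  then have "set_pmf (die m n) = set_pmf (die m' n')" by simp
  then have "{m..n} = {m'..n'}" using assms by (simp add: die_def set_pmf_of_set)
  then show "m = m' \<and> n = n'" using assms by auto
qed simp

lemma die_params_less: "(m, n) \<in> die_params \<Longrightarrow> m < n"
  by (auto simp: die_params_iff)

lemma die_mem_dice_iff:
  assumes "m \<le> n"
  shows "die m n \<in> dice \<longleftrightarrow> (m, n) \<in> die_params"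
  using assms die_params_less die_eq_iff unfolding dice_def
  by (blast dest: less_imp_le)

lemma infinite_dice: "infinite dice"
proof -
  \<comment> \<open>The parameter \<open>k = 3 t + 1\<close> yields \<open>3 m + 1 = k\<^sup>2\<close> with \<open>m = 3 t\<^sup>2 + 2 t\<close>.\<close>
  define m where "m t = 3 * t\<^sup>2 + 2 * t" for t :: nat
  define f where "f t = die (m t) (2 * (3 * t + 1) + m t + 2)" for t
  have "3 * m t + 1 = (3 * t + 1)\<^sup>2" for t
    by (simp add: m_def power2_eq_square algebra_simps)
  then have "f t \<in> dice" for t
    unfolding f_def by (subst die_mem_dice_iff) (auto simp: die_params_iff)
  then have "range f \<subseteq> dice" by auto
  moreover have "inj f"
    by (rule injI) (auto simp: f_def die_eq_iff)
  then have "infinite (range f)" by (rule range_inj_infinite)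
  ultimately show ?thesis by (rule infinite_super)
qed

section \<open>The limit of the ratio of the endpoints\<close>

text \<open>
  The exact ratio \<open>1 - 6 / (k + 5)\<close> is expressed through \<open>k\<close>, whereas the limit is taken over pairs
  \<open>(m, n)\<close>. Replacing \<open>k + 5\<close> by the smaller quantity \<open>sqrt n\<close> gives a bound that tends to \<open>1\<close>
  with \<open>n\<close> alone.
\<close>

lemma die_params_ratio_bounds:
  assumes "(m, n) \<in> die_params"
  shows "1 - 6 / sqrt (real n) \<le> real m / real n" "real m / real n \<le> 1"
proof -
  obtain k where k: "3 * m + 1 = k\<^sup>2" "n = 2 * k + m + 2"
    using assms unfolding die_params_iff by blast
  have m: "real m = ((real k)\<^sup>2 - 1) / 3"
    using arg_cong[OF k(1), of real] by simp
  have n: "real n = (real k + 1) * (real k + 5) / 3"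
    using k(2) m by (simp add: field_simps power2_eq_square)
  have ratio: "real m / real n = 1 - 6 / (real k + 5)"
  proof -
    have "real m = (real k + 1) * (real k - 1) / 3"
      by (simp add: m field_simps power2_eq_square)
    then have "real m / real n = (real k - 1) / (real k + 5)"
      by (simp add: n)
    also have "\<dots> = 1 - 6 / (real k + 5)" by (simp add: field_simps)
    finally show ?thesis .
  qed
  have "real n \<le> (real k + 5)\<^sup>2"
    unfolding n by (simp add: power2_eq_square field_simps)
  then have "sqrt (real n) \<le> real k + 5" by (intro real_le_lsqrt) auto
  moreover have "sqrt (real n) > 0" using k(2) by simp
  ultimately have "6 / (real k + 5) \<le> 6 / sqrt (real n)"
    by (intro divide_left_mono) auto
  then show "1 - 6 / sqrt (real n) \<le> real m / real n" by (simp add: ratio)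
  show "real m / real n \<le> 1" by (simp add: ratio)
qed

lemma ratio_tendsto_1: "((\<lambda>(m, n). real m / real n) \<longlongrightarrow> 1) along_params"
proof (rule tendsto_sandwich)
  have params: "\<forall>\<^sub>F x in along_params. x \<in> die_params"
    unfolding along_params_def by (simp add: eventually_inf_principal)
  show "\<forall>\<^sub>F x in along_params. 1 - 6 / sqrt (real (snd x)) \<le> (case x of (m, n) \<Rightarrow> real m / real n)"
    using params by eventually_elim (auto dest: die_params_ratio_bounds(1))
  show "\<forall>\<^sub>F x in along_params. (case x of (m, n) \<Rightarrow> real m / real n) \<le> (1 :: real)"
    using params by eventually_elim (auto dest: die_params_ratio_bounds(2))
  have "filterlim snd (at_top :: nat filter) along_params"
    unfolding along_params_def by (rule filterlim_mono[OF filterlim_snd order_refl inf_le1])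
  then have "filterlim (\<lambda>x. sqrt (real (snd x))) at_top along_params"
    by (intro filterlim_compose[OF sqrt_at_top] filterlim_compose[OF filterlim_real_sequentially])
  then have "((\<lambda>x. 1 - 6 / sqrt (real (snd x))) \<longlongrightarrow> 1 - 0) along_params"
    by (intro tendsto_diff tendsto_const real_tendsto_divide_at_top[OF tendsto_const])
  then show "((\<lambda>x. 1 - 6 / sqrt (real (snd x))) \<longlongrightarrow> 1) along_params" by simp
qed simp

section \<open>Prime factors of the support size\<close>

lemma prime_ge_5_iff:
  fixes p :: nat
  assumes "prime p"
  shows "p \<ge> 5 \<longleftrightarrow> p \<noteq> 2 \<and> p \<noteq> 3"
proof -
  have "p \<noteq> 4" using assms by (auto dest: prime_odd_nat)
  then show ?thesis using prime_ge_2_nat[OF assms] by auto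
qed

lemma prod_primes_ge_5_of_coprime_6:
  fixes N :: nat
  assumes "N > 1" "\<not> 2 dvd N" "\<not> 3 dvd N"
  shows "\<exists>P :: nat multiset. P \<noteq> {#} \<and> (\<forall>p \<in># P. prime p \<and> p \<ge> 5) \<and> N = prod_mset P"
proof (intro exI conjI ballI)
  show prod: "N = prod_mset (prime_factorization N)"
    using assms(1) by (simp add: prod_mset_prime_factorization_nat)
  show "prime_factorization N \<noteq> {#}"
    using assms(1) by (metis less_irrefl prod prod_mset_empty)
next
  fix p assume p: "p \<in># prime_factorization N"
  then show "prime p" by auto
  moreover have "p dvd N" using p by auto
  ultimately show "p \<ge> 5" using assms(2,3) by (auto simp: prime_ge_5_iff)
qed

text \<open>
  The support has \<open>2 k + 3\<close> elements; a factor \<open>3\<close> in it would divide \<open>k\<close> and hence \<open>k\<^sup>2 = 3 m + 1\<close>.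
\<close>

lemma die_params_size_coprime_6:
  assumes "(m, n) \<in> die_params"
  shows "n - m + 1 > 1" "\<not> 2 dvd n - m + 1" "\<not> 3 dvd n - m + 1"
proof -
  obtain k where k: "3 * m + 1 = k\<^sup>2" "n = 2 * k + m + 2"
    using assms unfolding die_params_iff by blast
  have size: "n - m + 1 = 2 * k + 3" using k(2) by simp
  show "n - m + 1 > 1" "\<not> 2 dvd n - m + 1" unfolding size by auto
  show "\<not> 3 dvd n - m + 1"
  proof
    assume "3 dvd n - m + 1"
    then have "3 dvd k" unfolding size by presburger
    then have "3 dvd k\<^sup>2" by (simp add: power2_eq_square)
    then show False unfolding k(1)[symmetric] by presburger
  qed
qed

section \<open>Enumeration of the orthogonal dice\<close>

theorem theorem3p1:
  shows "(\<forall>m n. m < n \<longrightarrow> (orthogonal_die m n \<longleftrightarrow> (m, n) \<in> die_params))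
    \<and> {die m n | m n. m < n \<and> orthogonal_die m n} = dice
    \<and> infinite dice
    \<and> ((\<lambda>(m, n). real m / real n) \<longlongrightarrow> 1) along_params
    \<and> (\<forall>m n. m < n \<longrightarrow> die m n \<in> dice \<longrightarrow>
         (\<exists>P :: nat multiset. P \<noteq> {#} \<and> (\<forall>p \<in># P. prime p \<and> p \<ge> 5) \<and> n - m + 1 = prod_mset P))"
proof (intro conjI)
  show "\<forall>m n. m < n \<longrightarrow> (orthogonal_die m n \<longleftrightarrow> (m, n) \<in> die_params)"
    using orthogonal_die_iff_params by blast
  show "{die m n | m n. m < n \<and> orthogonal_die m n} = dice"
    unfolding dice_def using orthogonal_die_iff_params die_params_less by blast
  show "infinite dice" by (rule infinite_dice)
  show "((\<lambda>(m, n). real m / real n) \<longlongrightarrow> 1) along_params" by (rule ratio_tendsto_1)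
  show "\<forall>m n. m < n \<longrightarrow> die m n \<in> dice \<longrightarrow>
      (\<exists>P :: nat multiset. P \<noteq> {#} \<and> (\<forall>p \<in># P. prime p \<and> p \<ge> 5) \<and> n - m + 1 = prod_mset P)"
    using die_mem_dice_iff die_params_size_coprime_6 prod_primes_ge_5_of_coprime_6
    by (metis less_imp_le)
qed

end
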